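(* Let $n\ge 3$ and let $v_i, v_j$ ($1\le i\ne j\le n$) be two cycle vertices of the wheel graph $W_{n+1}$, and let $k=\min(|i-j|,\, n-|i-j|)$ be their distance along the rim cycle. Then the number $F_{W_{n+1}}(v_i\mid v_j)$ of two-component spanning forests of $W_{n+1}$ in which $v_i$ and $v_j$ belong to different components is \[ F_{W_{n+1}}(v_i\mid v_j)= f_{2k}\,\mathscr{T}(W_{n+1}) - f_{2n}(\ell_{2k}-2) = f_{2k}(\ell_{2n}-2)-f_{2n}(\ell_{2k}-2), \] where $\mathscr{T}(W_{n+1})$ is the number of spanning trees of $W_{n+1}$.
   Context: The wheel graph $W_{n+1}$ has vertices $v_c, v_1,\dots,v_n$; its edges are the spokes $\{v_c,v_i\}$ and the cycle edges $\{v_i,v_{i+1}\}$ ($1\le i\le n-1$) and $\{v_n,v_1\}$. A two-component spanning forest is an acyclic spanning subgraph with exactly two connected components. $f_i$ are the Fibonacci numbers ($f_0=0$, $f_1=1$, $f_{i+2}=f_{i+1}+f_i$) and $\ell_j$ the Lucas numbers ($\ell_0=2$, $\ell_1=1$, $\ell_{j+2}=\ell_{j+1}+\ell_j$). *)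

theory Defs
  imports "HOL-Number_Theory.Fib"
begin

text \<open>
  A simple graph is given by a vertex set \<open>V\<close> and a set \<open>E\<close> of two-element subsets of \<open>V\<close>.
  Since a spanning subgraph keeps all of \<open>V\<close>, it is identified with its edge set \<open>F \<subseteq> E\<close>.
\<close>

definition adjacent :: "'a set set \<Rightarrow> 'a \<Rightarrow> 'a \<Rightarrow> bool" where
  "adjacent E u v \<longleftrightarrow> {u, v} \<in> E"

text \<open>Listing at least three distinct vertices excludes traversing one edge back and forth.\<close>

definition is_cycle :: "'a set set \<Rightarrow> 'a list \<Rightarrow> bool" where
  "is_cycle E vs \<longleftrightarrow> length vs \<ge> 3 \<and> distinct vs \<and>
     successively (adjacent E) vs \<and> adjacent E (last vs) (hd vs)"

definition acyclic_graph :: "'a set set \<Rightarrow> bool" where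
  "acyclic_graph E \<longleftrightarrow> (\<nexists>vs. is_cycle E vs)"

definition joined :: "'a set \<Rightarrow> 'a set set \<Rightarrow> ('a \<times> 'a) set" where
  "joined V E = {(u, v). u \<in> V \<and> v \<in> V \<and> (adjacent E)\<^sup>*\<^sup>* u v}"

definition components :: "'a set \<Rightarrow> 'a set set \<Rightarrow> 'a set set" where
  "components V E = V // joined V E"

definition connected_graph :: "'a set \<Rightarrow> 'a set set \<Rightarrow> bool" where
  "connected_graph V E \<longleftrightarrow> V \<noteq> {} \<and> (\<forall>u\<in>V. \<forall>v\<in>V. (u, v) \<in> joined V E)"

definition spanning_trees :: "'a set \<Rightarrow> 'a set set \<Rightarrow> 'a set set set" where
  "spanning_trees V E = {F. F \<subseteq> E \<and> acyclic_graph F \<and> connected_graph V F}"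

definition two_forests :: "'a set \<Rightarrow> 'a set set \<Rightarrow> 'a set set set" where
  "two_forests V E = {F. F \<subseteq> E \<and> acyclic_graph F \<and> card (components V F) = 2}"

definition separating_two_forests :: "'a set \<Rightarrow> 'a set set \<Rightarrow> 'a \<Rightarrow> 'a \<Rightarrow> 'a set set set" where
  "separating_two_forests V E u v =
     {F \<in> two_forests V E.
        \<exists>C\<in>components V F. \<exists>D\<in>components V F. C \<noteq> D \<and> u \<in> C \<and> v \<in> D}"

text \<open>The wheel \<open>W\<^bsub>n+1\<^esub>\<close>: the centre is \<open>0\<close> and the rim vertex \<open>v\<^sub>i\<close> is \<open>i\<close>, for \<open>1 \<le> i \<le> n\<close>.\<close>

definition wheel_verts :: "nat \<Rightarrow> nat set" where
  "wheel_verts n = insert 0 {1..n}"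

definition wheel_edges :: "nat \<Rightarrow> nat set set" where
  "wheel_edges n =
     {{0, i} |i. 1 \<le> i \<and> i \<le> n} \<union> {{i, i + 1} |i. 1 \<le> i \<and> i \<le> n - 1} \<union> {{n, 1}}"

fun lucas :: "nat \<Rightarrow> nat" where
  "lucas 0 = 2"
| "lucas (Suc 0) = 1"
| "lucas (Suc (Suc n)) = lucas (Suc n) + lucas n"

end

theory Submission
  imports Defs
begin

text \<open>
  Deleting an edge \<open>uv\<close> from the spanning trees that contain it gives
  \<open>T(G + uv) = T(G) + F\<^sub>G(u | v)\<close>, and splitting a forest at its components gives
  \<open>F\<^sub>G(u | v) = \<Sum>\<^sub>C T(G[C]) T(G - C)\<close> over the vertex sets \<open>C\<close> with \<open>u \<in> C\<close>, \<open>v \<notin> C\<close>.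
  In a fan or a wheel, one of \<open>C\<close> and its complement avoids the hub; it contributes only if it is
  an arc of the rim, which has a single spanning tree, and then the rest is a fan.
  Thus a fan with \<open>m \<ge> 1\<close> rim vertices has \<open>f\<^bsub>2m\<^esub>\<close> spanning trees, the wheel has
  \<open>f\<^bsub>2n\<^esub> + 2(f\<^sub>2 + \<dots> + f\<^bsub>2n-2\<^esub>) = \<ell>\<^bsub>2n\<^esub> - 2\<close>, and
  \<open>F(v\<^sub>i | v\<^sub>j) = 2(f\<^bsub>2n\<^esub> - f\<^bsub>2k\<^esub> - f\<^bsub>2n-2k\<^esub>)\<close>, which is the claim because
  \<open>f\<^bsub>2n\<^esub> \<ell>\<^bsub>2k\<^esub> - f\<^bsub>2k\<^esub> \<ell>\<^bsub>2n\<^esub> = 2 f\<^bsub>2n-2k\<^esub>\<close>.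
\<close>

subsection \<open>Reachability and acyclicity\<close>

abbreviation (input) reach :: "'a set set \<Rightarrow> 'a \<Rightarrow> 'a \<Rightarrow> bool" where
  "reach E \<equiv> (adjacent E)\<^sup>*\<^sup>*"

lemma adjacent_commute: "adjacent E u v \<longleftrightarrow> adjacent E v u"
  by (simp add: adjacent_def insert_commute)

lemma reach_sym: "reach E u v \<Longrightarrow> reach E v u"
  by (metis adjacent_commute sympI symp_rtranclp sympD)

lemma reach_mono: "reach E u v \<Longrightarrow> E \<subseteq> E' \<Longrightarrow> reach E' u v"
  by (erule rtranclp_mono[THEN predicate2D, rotated]) (auto simp: adjacent_def)

lemma reach_closed:
  assumes "reach E u v" "u \<in> S" "\<And>x y. x \<in> S \<Longrightarrow> adjacent E x y \<Longrightarrow> y \<in> S"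
  shows "v \<in> S"
  using assms(1,2) by (induction rule: rtranclp_induct) (auto intro: assms(3))

text \<open>Reachability passes to another edge set along a walk that is trapped in
  \<open>S\<close>. This is how connectivity of a component is transferred to the subgraph induced
  on it.\<close>

lemma reach_within:
  assumes "reach E u v" "u \<in> S" "\<And>x y. x \<in> S \<Longrightarrow> adjacent E x y \<Longrightarrow> y \<in> S \<and> adjacent E' x y"
  shows "reach E' u v"
proof -
  have "reach E' u v \<and> v \<in> S"
    using assms(1,2)
    by (induction rule: rtranclp_induct) (auto dest: assms(3) intro: rtranclp.rtrancl_into_rtrancl)
  then show ?thesis ..
qed

text \<open>Crossing the new edge twice gains nothing: the part of the walk between the crossings
  can be cut out. In the induction, a step over the new edge lands in one of the cases already
  listed.\<close>

lemma reach_insert_iff: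
  "reach (insert {u, v} E) x y \<longleftrightarrow>
     reach E x y \<or> reach E x u \<and> reach E v y \<or> reach E x v \<and> reach E u y"
    (is "?L \<longleftrightarrow> ?R")
proof
  assume ?L
  then show ?R
  proof (induction rule: rtranclp_induct)
    case base
    then show ?case by simp
  next
    case (step y z)
    from step.hyps(2) have "adjacent E y z \<or> y = u \<and> z = v \<or> y = v \<and> z = u"
      by (auto simp: adjacent_def doubleton_eq_iff)
    with step.IH show ?case
      by (auto intro: rtranclp.rtrancl_into_rtrancl dest: reach_sym)
  qed
next
  have E: "reach E a b \<Longrightarrow> reach (insert {u, v} E) a b" for a b
    by (erule reach_mono) auto
  have uv: "reach (insert {u, v} E) u v" "reach (insert {u, v} E) v u"
    by (auto simp: adjacent_def insert_commute)
  assume ?R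
  then show ?L
    using E uv by (elim disjE conjE) (blast intro: rtranclp_trans)+
qed

text \<open>\<open>is_cycle\<close> asks for distinct vertices, so walks must be shortened to paths.
  The path grows at its front; if the new vertex already lies on it, everything before that vertex
  is dropped.\<close>

lemma reach_distinct_path:
  assumes "reach E u v"
  obtains vs where "vs \<noteq> []" "hd vs = u" "last vs = v" "distinct vs" "successively (adjacent E) vs"
proof -
  have "\<exists>vs. vs \<noteq> [] \<and> hd vs = u \<and> last vs = v \<and> distinct vs \<and> successively (adjacent E) vs"
    using assms
  proof (induction rule: converse_rtranclp_induct)
    case base
    show ?case by (intro exI[of _ "[v]"]) auto
  next
    case (step x y)
    then obtain vs where vs: "vs \<noteq> []" "hd vs = y" "last vs = v" "distinct vs"
      "successively (adjacent E) vs" by blast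
    show ?case
    proof (cases "x \<in> set vs")
      case True
      then obtain ps qs where "vs = ps @ x # qs" by (meson split_list)
      with vs show ?thesis
        by (intro exI[of _ "x # qs"]) (auto simp: successively_append_iff split: if_splits)
    next
      case False
      with vs step.hyps show ?thesis
        by (intro exI[of _ "x # vs"]) (auto simp: successively_Cons)
    qed
  qed
  with that show ?thesis by blast
qed

lemma successively_reach: "successively (adjacent E) vs \<Longrightarrow> vs \<noteq> [] \<Longrightarrow> reach E (hd vs) (last vs)"
proof (induction vs rule: induct_list012)
  case (3 x y zs)
  then show ?case using converse_rtranclp_into_rtranclp[of "adjacent E" x y] by simp
qed auto

text \<open>A graph is a forest iff each of its edges is a bridge. From here on only reachability is
  used, no longer lists of cycle vertices.\<close>

lemma acyclic_graph_iff:
  "acyclic_graph E \<longleftrightarrow>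
     (\<forall>u v. u \<noteq> v \<longrightarrow> {u, v} \<in> E \<longrightarrow> \<not> reach (E - {{u, v}}) u v)"
proof -
  have "\<exists>u v. u \<noteq> v \<and> {u, v} \<in> E \<and> reach (E - {{u, v}}) u v" if "is_cycle E vs" for vs
  proof -
    from that have vs: "length vs \<ge> 3" "distinct vs" "successively (adjacent E) vs"
      "adjacent E (last vs) (hd vs)" by (auto simp: is_cycle_def)
    \<comment> \<open>Without its closing edge the cycle still joins its two ends. The length bound
      ensures that no consecutive pair of the list is that closing edge.\<close>
    let ?E = "E - {{hd vs, last vs}}"
    from vs(1) have ne: "vs \<noteq> []" by auto
    have "successively (adjacent ?E) vs"
      unfolding successively_conv_nth
    proof (intro allI impI)
      fix i assume i: "Suc i < length vs"
      have "adjacent E (vs ! i) (vs ! Suc i)" using vs(3) i by (simp add: successively_conv_nth)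
      moreover have "{vs ! i, vs ! Suc i} \<noteq> {vs ! 0, vs ! (length vs - 1)}"
      proof -
        have "0 < length vs" "i < length vs" "length vs - 1 < length vs" using i by linarith+
        then show ?thesis using vs(1,2) i by (auto simp: doubleton_eq_iff nth_eq_iff_index_eq)
      qed
      ultimately show "adjacent ?E (vs ! i) (vs ! Suc i)"
        using ne by (auto simp: adjacent_def hd_conv_nth last_conv_nth)
    qed
    then have "reach ?E (hd vs) (last vs)" using ne by (rule successively_reach)
    moreover have "hd vs \<noteq> last vs"
      using vs(1,2) ne by (auto simp: hd_conv_nth last_conv_nth nth_eq_iff_index_eq)
    moreover have "{hd vs, last vs} \<in> E"
      using vs(4) by (simp add: adjacent_def insert_commute)
    ultimately show ?thesis by blast
  qed
  moreover have "\<exists>vs. is_cycle E vs"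
    if uv: "u \<noteq> v" "{u, v} \<in> E" and r: "reach (E - {{u, v}}) u v" for u v
  proof -
    from r obtain vs where vs: "vs \<noteq> []" "hd vs = u" "last vs = v" "distinct vs"
      "successively (adjacent (E - {{u, v}})) vs" by (rule reach_distinct_path)
    \<comment> \<open>Length 1 would give \<open>u = v\<close>, and length 2 would use the deleted
      edge.\<close>
    have "length vs \<noteq> 1" "length vs \<noteq> 2"
      using vs uv(1) by (auto simp: length_Suc_conv numeral_2_eq_2 adjacent_def)
    moreover have "length vs \<noteq> 0" using vs by auto
    ultimately have "length vs \<ge> 3" by linarith
    moreover have "successively (adjacent E) vs"
      using vs(5) by (rule successively_mono) (auto simp: adjacent_def)
    moreover have "adjacent E (last vs) (hd vs)"
      using vs uv by (auto simp: adjacent_def insert_commute)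
    ultimately show ?thesis using vs(4) unfolding is_cycle_def by blast
  qed
  ultimately show ?thesis unfolding acyclic_graph_def by blast
qed

lemma acyclic_graph_subset: "acyclic_graph E \<Longrightarrow> F \<subseteq> E \<Longrightarrow> acyclic_graph F"
  unfolding acyclic_graph_iff by (blast intro: reach_mono)

lemma acyclic_graph_insert_iff:
  assumes "u \<noteq> v" "{u, v} \<notin> E"
  shows "acyclic_graph (insert {u, v} E) \<longleftrightarrow> acyclic_graph E \<and> \<not> reach E u v"
proof
  assume "acyclic_graph (insert {u, v} E)"
  then show "acyclic_graph E \<and> \<not> reach E u v"
    using assms acyclic_graph_subset[of "insert {u, v} E" E]
    by (auto simp: acyclic_graph_iff)
next
  assume E: "acyclic_graph E \<and> \<not> reach E u v"
  show "acyclic_graph (insert {u, v} E)"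
    unfolding acyclic_graph_iff
  proof (intro allI impI)
    fix x y assume xy: "x \<noteq> y" "{x, y} \<in> insert {u, v} E"
    show "\<not> reach (insert {u, v} E - {{x, y}}) x y"
    proof (cases "{x, y} = {u, v}")
      case True
      then have "insert {u, v} E - {{x, y}} = E" using assms(2) by auto
      moreover have "\<not> reach E x y" using E True by (auto simp: doubleton_eq_iff dest: reach_sym)
      ultimately show ?thesis by simp
    next
      case False
      let ?E = "E - {{x, y}}"
      have e: "{x, y} \<in> E" using xy False by auto
      have "\<not> reach ?E x y" using E e xy(1) by (auto simp: acyclic_graph_iff)
      \<comment> \<open>If x and y were joined through the new edge, the edge xy together with the
        two remaining pieces would already join u and v in \<open>E\<close>.\<close>
      moreover have "\<not> (reach ?E x u \<and> reach ?E v y)" "\<not> (reach ?E x v \<and> reach ?E u y)"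
      proof -
        have 1: "reach E a b" if "reach ?E a b" for a b using that by (rule reach_mono) auto
        have 2: "reach E x y" using e by (auto simp: adjacent_def)
        show "\<not> (reach ?E x u \<and> reach ?E v y)" "\<not> (reach ?E x v \<and> reach ?E u y)"
          using 1 2 E by (meson reach_sym rtranclp_trans)+
      qed
      ultimately have "\<not> reach (insert {u, v} ?E) x y" by (simp add: reach_insert_iff)
      moreover have "insert {u, v} E - {{x, y}} = insert {u, v} ?E" using False by auto
      ultimately show ?thesis by simp
    qed
  qed
qed

subsection \<open>Spanning trees and separating two-forests\<close>

definition simple_graph :: "'a set \<Rightarrow> 'a set set \<Rightarrow> bool" where
  "simple_graph V E \<longleftrightarrow> finite V \<and> (\<forall>e\<in>E. \<exists>u\<in>V. \<exists>v\<in>V. u \<noteq> v \<and> e = {u, v})"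

definition induced :: "'a set set \<Rightarrow> 'a set \<Rightarrow> 'a set set" where
  "induced E S = {e \<in> E. e \<subseteq> S}"

abbreviation (input) num_trees :: "'a set \<Rightarrow> 'a set set \<Rightarrow> nat" where
  "num_trees V E \<equiv> card (spanning_trees V E)"

lemma simple_graphD:
  assumes "simple_graph V E"
  shows "finite V" "finite E" "adjacent E u v \<Longrightarrow> u \<in> V \<and> v \<in> V \<and> u \<noteq> v" "E \<subseteq> Pow V"
proof -
  show "finite V" and E: "E \<subseteq> Pow V" using assms by (auto simp: simple_graph_def)
  then show "finite E" by (meson finite_Pow_iff finite_subset)
  show "adjacent E u v \<Longrightarrow> u \<in> V \<and> v \<in> V \<and> u \<noteq> v"
    using assms by (auto simp: simple_graph_def adjacent_def doubleton_eq_iff)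
qed

lemma simple_graph_mono: "simple_graph V E \<Longrightarrow> F \<subseteq> E \<Longrightarrow> V \<subseteq> W \<Longrightarrow> finite W \<Longrightarrow> simple_graph W F"
  unfolding simple_graph_def by (meson subsetD)

lemma simple_graph_induced:
  assumes "simple_graph V E" "S \<subseteq> V" shows "simple_graph S (induced E S)"
  unfolding simple_graph_def induced_def
proof (intro conjI ballI)
  show "finite S" using assms by (meson finite_subset simple_graphD(1))
  fix e assume e: "e \<in> {e \<in> E. e \<subseteq> S}"
  with assms(1) obtain u v where "u \<noteq> v" "e = {u, v}" by (auto simp: simple_graph_def)
  with e show "\<exists>u\<in>S. \<exists>v\<in>S. u \<noteq> v \<and> e = {u, v}" by auto
qed

lemma finite_spanning_trees: "finite E \<Longrightarrow> finite (spanning_trees V E)"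
  by (rule finite_subset[of _ "Pow E"]) (auto simp: spanning_trees_def)

text \<open>Used contrapositively: a vertex set that is not connected contributes 0 to the sums over
  components.\<close>

lemma connected_if_num_trees:
  assumes "num_trees V E \<noteq> 0" "u \<in> V" "v \<in> V"
  shows "reach E u v"
proof -
  from assms(1) obtain F where "F \<in> spanning_trees V E" by fastforce
  then have "reach F u v" "F \<subseteq> E"
    using assms by (auto simp: spanning_trees_def connected_graph_def joined_def)
  then show ?thesis by (rule reach_mono)
qed

text \<open>Components are equivalence classes. Once u and v lie in different ones, having exactly
  two classes means that no vertex lies outside these two. Counting components is thereby reduced to
  reachability.\<close>

lemma separating_iff:
  assumes "u \<in> V" "v \<in> V"
  shows "F \<in> separating_two_forests V E u v \<longleftrightarrow>
    F \<subseteq> E \<and> acyclic_graph F \<and> \<not> reach F u v \<and> (\<forall>w\<in>V. reach F u w \<or> reach F v w)"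
proof -
  let ?r = "joined V F"
  have eq: "equiv V ?r"
    by (rule equivI) (auto simp: refl_on_def sym_def trans_def joined_def dest: reach_sym)
  have cls: "C \<in> components V F \<Longrightarrow> x \<in> C \<Longrightarrow> C = ?r `` {x}" for C x
    unfolding components_def
    by (metis eq equiv_class_eq_iff Image_singleton_iff quotientE)
  have mem: "x \<in> V \<Longrightarrow> ?r `` {x} \<in> components V F" for x
    by (auto simp: components_def intro: quotientI)
  have neq: "?r `` {u} \<noteq> ?r `` {v} \<longleftrightarrow> \<not> reach F u v"
    using eq_equiv_class_iff[OF eq assms] assms by (auto simp: joined_def)
  have self: "x \<in> V \<Longrightarrow> x \<in> ?r `` {x}" for x by (auto simp: joined_def)
  have two: "card (components V F) = 2 \<longleftrightarrow> (\<forall>w\<in>V. reach F u w \<or> reach F v w)"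
    if nr: "\<not> reach F u v"
  proof
    assume "card (components V F) = 2"
    then obtain X Y where XY: "components V F = {X, Y}" by (auto simp: card_2_iff)
    then have *: "components V F = {?r `` {u}, ?r `` {v}}"
      using mem[OF assms(1)] mem[OF assms(2)] neq nr by auto
    show "\<forall>w\<in>V. reach F u w \<or> reach F v w"
    proof
      fix w assume w: "w \<in> V"
      from mem[OF w] * have "w \<in> ?r `` {u} \<or> w \<in> ?r `` {v}" using self[OF w] by auto
      then show "reach F u w \<or> reach F v w" by (auto simp: joined_def)
    qed
  next
    assume *: "\<forall>w\<in>V. reach F u w \<or> reach F v w"
    have "components V F = {?r `` {u}, ?r `` {v}}"
    proof (intro subset_antisym subsetI)
      fix C assume "C \<in> components V F"
      then obtain w where w: "w \<in> V" "C = ?r `` {w}" by (auto simp: components_def quotient_def)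
      then have "(u, w) \<in> ?r \<or> (v, w) \<in> ?r" using * assms by (auto simp: joined_def)
      then show "C \<in> {?r `` {u}, ?r `` {v}}" using w equiv_class_eq[OF eq] by blast
    qed (use mem assms in auto)
    then show "card (components V F) = 2" using neq nr by simp
  qed
  have "(\<exists>C\<in>components V F. \<exists>D\<in>components V F. C \<noteq> D \<and> u \<in> C \<and> v \<in> D) \<longleftrightarrow> \<not> reach F u v"
    using cls mem self neq assms by metis
  with two show ?thesis
    unfolding separating_two_forests_def two_forests_def by blast
qed

lemma separating_commute:
  "separating_two_forests V E u v = separating_two_forests V E v u"
  unfolding separating_two_forests_def by blast

lemma num_trees_insert:
  assumes "simple_graph V E" "u \<in> V" "v \<in> V" "u \<noteq> v" "{u, v} \<notin> E"
  shows "num_trees V (insert {u, v} E) = num_trees V E + card (separating_two_forests V E u v)"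
proof -
  let ?S = "separating_two_forests V E u v" and ?e = "{u, v}"
  \<comment> \<open>Adding the edge uv merges the two components, and a spanning tree results;
    conversely the edge is a bridge of any tree containing it. So the trees through uv are the image
    of \<open>?S\<close> under inserting it.\<close>
  have S: "F \<in> ?S \<longleftrightarrow> F \<subseteq> E \<and> insert ?e F \<in> spanning_trees V (insert ?e E)" for F
  proof (cases "F \<subseteq> E")
    case True
    then have "?e \<notin> F" using assms by auto
    moreover have "(\<forall>x\<in>V. \<forall>y\<in>V. reach (insert ?e F) x y) \<longleftrightarrow> (\<forall>w\<in>V. reach F u w \<or> reach F v w)"
      if "\<not> reach F u v"
      unfolding reach_insert_iff using that assms(2,3)
      by (metis (no_types) reach_sym rtranclp.rtrancl_refl rtranclp_trans)
    ultimately show ?thesis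
      using True assms
      by (auto simp: separating_iff spanning_trees_def acyclic_graph_insert_iff connected_graph_def
          joined_def)
  qed (use assms in \<open>auto simp: separating_iff\<close>)
  have "spanning_trees V (insert ?e E) = spanning_trees V E \<union> insert ?e ` ?S"
  proof (intro subset_antisym subsetI)
    fix F assume F: "F \<in> spanning_trees V (insert ?e E)"
    show "F \<in> spanning_trees V E \<union> insert ?e ` ?S"
    proof (cases "?e \<in> F")
      case True
      then have "F = insert ?e (F - {?e})" by auto
      moreover have "F - {?e} \<in> ?S"
        unfolding S using F True by (auto simp: spanning_trees_def insert_absorb)
      ultimately show ?thesis by blast
    next
      case False
      then show ?thesis using F by (auto simp: spanning_trees_def)
    qed
  qed (use S in \<open>auto simp: spanning_trees_def\<close>)
  moreover have "spanning_trees V E \<inter> insert ?e ` ?S = {}"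
    using assms(5) by (auto simp: spanning_trees_def)
  moreover have "inj_on (insert ?e) ?S"
  proof (rule inj_onI)
    fix F G assume "F \<in> ?S" "G \<in> ?S" "insert ?e F = insert ?e G"
    moreover from this have "?e \<notin> F" "?e \<notin> G" using assms(5) S by blast+
    ultimately show "F = G" by (simp add: insert_ident)
  qed
  moreover have "finite ?S"
    using simple_graphD(2)[OF assms(1)] S by (intro finite_subset[of ?S "Pow E"]) blast+
  ultimately show ?thesis
    using finite_spanning_trees[OF simple_graphD(2)[OF assms(1)], of V]
    by (simp add: card_Un_disjoint card_image)
qed

lemma acyclic_graph_disjoint_Un:
  assumes "simple_graph C E" "simple_graph D F" "C \<inter> D = {}" "acyclic_graph E" "acyclic_graph F"
  shows "acyclic_graph (E \<union> F)"
proof -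
  \<comment> \<open>A walk that starts in \<open>C\<close> cannot leave it, so it uses edges of
    \<open>E\<close> only. The claim is stated for arbitrary sets so that it also applies with the
    two sides exchanged.\<close>
  have *: "\<not> reach (E \<union> F - {{u, v}}) u v"
    if "simple_graph C E" "simple_graph D F" "C \<inter> D = {}" "acyclic_graph E" "u \<noteq> v" "{u, v} \<in> E"
    for C D :: "'a set" and E F u v
  proof
    assume r: "reach (E \<union> F - {{u, v}}) u v"
    have "reach (E - {{u, v}}) u v"
    proof (rule reach_within[OF r, of C])
      show "u \<in> C" using that by (auto simp: simple_graph_def doubleton_eq_iff)
      fix x y assume "x \<in> C" "adjacent (E \<union> F - {{u, v}}) x y"
      then show "y \<in> C \<and> adjacent (E - {{u, v}}) x y"
        using that simple_graphD(3)[OF that(1), of x y] simple_graphD(3)[OF that(2), of x y]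
        by (auto simp: adjacent_def)
    qed
    with that show False by (auto simp: acyclic_graph_iff)
  qed
  show ?thesis
    unfolding acyclic_graph_iff
    using *[OF assms(1-4)] *[OF assms(2,1) _ assms(5)] assms(3)
    by (metis Un_commute Un_iff inf_commute)
qed

lemma card_separating_two_forests:
  assumes "simple_graph V E" "u \<in> V" "v \<in> V"
  shows "card (separating_two_forests V E u v) =
    (\<Sum>C | C \<subseteq> V \<and> u \<in> C \<and> v \<notin> C.
       num_trees C (induced E C) * num_trees (V - C) (induced E (V - C)))"
proof -
  let ?I = "{C. C \<subseteq> V \<and> u \<in> C \<and> v \<notin> C}"
  let ?P = "\<lambda>C. spanning_trees C (induced E C) \<times> spanning_trees (V - C) (induced E (V - C))"
  have fV: "finite V" "finite E" using simple_graphD[OF assms(1)] by auto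
  have tree: "simple_graph C A" "A \<subseteq> E" "A \<subseteq> Pow C" "acyclic_graph A"
    "x \<in> C \<Longrightarrow> y \<in> C \<Longrightarrow> reach A x y"
    if "A \<in> spanning_trees C (induced E C)" "C \<subseteq> V" for A C x y
  proof -
    have A: "A \<subseteq> induced E C" using that by (auto simp: spanning_trees_def)
    then show "A \<subseteq> E" "A \<subseteq> Pow C" by (auto simp: induced_def)
    show "simple_graph C A"
      using simple_graph_mono[OF simple_graph_induced[OF assms(1) that(2)] A order_refl]
        that(2) fV(1) by (meson finite_subset)
    show "acyclic_graph A" "x \<in> C \<Longrightarrow> y \<in> C \<Longrightarrow> reach A x y"
      using that by (auto simp: spanning_trees_def connected_graph_def joined_def)
  qed
  have "bij_betw (\<lambda>(C, A, B). A \<union> B) (Sigma ?I ?P) (separating_two_forests V E u v)"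
  \<comment> \<open>A forest is sent to the component \<open>C\<close> of u and to the edges it has
    inside \<open>C\<close> and inside the complement; the inverse map is the union of two
    trees.\<close>
  proof (rule bij_betw_byWitness[where f' = "\<lambda>F. ({w \<in> V. reach F u w},
        induced F {w \<in> V. reach F u w}, induced F (V - {w \<in> V. reach F u w}))"])
    have split: "{w \<in> V. reach (A \<union> B) u w} = C"
      if C: "C \<in> ?I" and A: "A \<in> spanning_trees C (induced E C)"
        and B: "B \<in> spanning_trees (V - C) (induced E (V - C))" for C A B
    proof (intro subset_antisym subsetI)
      fix w assume "w \<in> {w \<in> V. reach (A \<union> B) u w}"
      then have r: "reach (A \<union> B) u w" by simp
      show "w \<in> C"
      proof (rule reach_closed[OF r])
        show "u \<in> C" using C by simp
        fix x y assume "x \<in> C" "adjacent (A \<union> B) x y"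
        moreover have "A \<subseteq> Pow C" "B \<subseteq> Pow (V - C)"
          using tree(3)[OF A] tree(3)[OF B] C by auto
        ultimately show "y \<in> C" by (auto simp: adjacent_def)
      qed
    next
      fix w assume w: "w \<in> C"
      then have "reach A u w" using C tree(5)[OF A] by auto
      then have "reach (A \<union> B) u w" by (rule reach_mono) simp
      then show "w \<in> {w \<in> V. reach (A \<union> B) u w}" using w C by auto
    qed
    have ind: "induced (A \<union> B) C = A" "induced (A \<union> B) (V - C) = B"
      if C: "C \<in> ?I" and A: "A \<in> spanning_trees C (induced E C)"
        and B: "B \<in> spanning_trees (V - C) (induced E (V - C))" for C A B
    proof -
      \<comment> \<open>An empty edge would be counted as induced on both sides; a nonempty one
        belongs to exactly one of them.\<close>
      have ne: "{} \<notin> A" "{} \<notin> B"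
        using tree(1)[OF A] tree(1)[OF B] C by (auto simp: simple_graph_def)
      have AB: "A \<subseteq> Pow C" "B \<subseteq> Pow (V - C)"
        using tree(3)[OF A] tree(3)[OF B] C by auto
      have "\<not> e \<subseteq> C" if "e \<in> B" for e
      proof -
        have "e \<noteq> {}" "e \<subseteq> V - C" using that ne AB by auto
        then show ?thesis by blast
      qed
      moreover have "\<not> e \<subseteq> V - C" if "e \<in> A" for e
      proof -
        have "e \<noteq> {}" "e \<subseteq> C" using that ne AB by auto
        then show ?thesis by blast
      qed
      ultimately show "induced (A \<union> B) C = A" "induced (A \<union> B) (V - C) = B"
        using AB by (auto simp: induced_def)
    qed
    show "\<forall>a\<in>Sigma ?I ?P. (\<lambda>F. ({w \<in> V. reach F u w}, induced F {w \<in> V. reach F u w},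
        induced F (V - {w \<in> V. reach F u w}))) ((\<lambda>(C, A, B). A \<union> B) a) = a"
      using split ind by auto
    show "(\<lambda>(C, A, B). A \<union> B) ` Sigma ?I ?P \<subseteq> separating_two_forests V E u v"
    proof clarify
      fix C A B
      assume C: "C \<subseteq> V" "u \<in> C" "v \<notin> C" and A: "A \<in> spanning_trees C (induced E C)"
        and B: "B \<in> spanning_trees (V - C) (induced E (V - C))"
      have "acyclic_graph (A \<union> B)"
        using tree(1,4)[OF A] tree(1,4)[OF B] C by (intro acyclic_graph_disjoint_Un) auto
      moreover have "\<not> reach (A \<union> B) u v" using split[OF _ A B] C assms by auto
      moreover have "reach (A \<union> B) u w \<or> reach (A \<union> B) v w" if "w \<in> V" for w
      proof (cases "w \<in> C")
        case True
        then show ?thesis using split[OF _ A B] C by auto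
      next
        case False
        then have "reach B v w" using tree(5)[OF B] C that assms by auto
        then show ?thesis by (meson reach_mono sup_ge2)
      qed
      ultimately show "A \<union> B \<in> separating_two_forests V E u v"
        using tree(2)[OF A] tree(2)[OF B] C assms by (auto simp: separating_iff)
    qed
    have sep: "F = induced F C \<union> induced F (V - C)"
        "C \<in> ?I" "induced F C \<in> spanning_trees C (induced E C)"
        "induced F (V - C) \<in> spanning_trees (V - C) (induced E (V - C))"
      if F: "F \<in> separating_two_forests V E u v" and C: "C = {w \<in> V. reach F u w}" for F C
    proof -
      have F': "F \<subseteq> E" "acyclic_graph F" "\<not> reach F u v"
        "\<And>w. w \<in> V \<Longrightarrow> reach F u w \<or> reach F v w"
        using F assms by (auto simp: separating_iff)
      have sg: "simple_graph V F" using assms(1) F'(1) by (meson fV(1) order_refl simple_graph_mono)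
      \<comment> \<open>No edge of \<open>F\<close> leaves the component of u, so \<open>F\<close>
        is recovered from its two induced parts and each part stays connected.\<close>
      have same: "reach F u x \<longleftrightarrow> reach F u y" if "adjacent F x y" for x y
        using that adjacent_commute by (metis rtranclp.rtrancl_into_rtrancl)
      show "F = induced F C \<union> induced F (V - C)"
      proof (intro subset_antisym subsetI)
        fix e assume e: "e \<in> F"
        then obtain x y where "e = {x, y}" "x \<in> V" "y \<in> V"
          using sg by (auto simp: simple_graph_def)
        then show "e \<in> induced F C \<union> induced F (V - C)"
          using same[of x y] e C by (auto simp: induced_def adjacent_def)
      qed (auto simp: induced_def)
      show "C \<in> ?I" using C F' assms by auto
      have ac: "acyclic_graph (induced F S)" for S
        using F'(2) by (rule acyclic_graph_subset) (auto simp: induced_def)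
      have su: "induced F S \<subseteq> induced E S" for S using F'(1) by (auto simp: induced_def)
      have con: "connected_graph C (induced F C)"
      proof -
        have "reach (induced F C) u w" if "w \<in> C" for w
        proof (rule reach_within[of F _ _ C])
          show "reach F u w" using that C by simp
          show "u \<in> C" using assms C by simp
          fix x y assume "x \<in> C" "adjacent F x y"
          then show "y \<in> C \<and> adjacent (induced F C) x y"
            using same[of x y] simple_graphD(3)[OF sg] C by (auto simp: induced_def adjacent_def)
        qed
        then show ?thesis
          using C assms unfolding connected_graph_def joined_def
          by (auto dest: reach_sym intro: rtranclp_trans)
      qed
      have con': "connected_graph (V - C) (induced F (V - C))"
      proof -
        have "reach (induced F (V - C)) v w" if "w \<in> V - C" for w
        proof (rule reach_within[of F _ _ "V - C"])
          show "reach F v w" using that C F'(4) by auto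
          show "v \<in> V - C" using assms C F'(3) by simp
          fix x y assume "x \<in> V - C" "adjacent F x y"
          then show "y \<in> V - C \<and> adjacent (induced F (V - C)) x y"
            using same[of x y] simple_graphD(3)[OF sg] C by (auto simp: induced_def adjacent_def)
        qed
        moreover have "v \<in> V - C" using assms C F'(3) by simp
        ultimately show ?thesis
          unfolding connected_graph_def joined_def
          by (auto dest: reach_sym intro: rtranclp_trans)
      qed
      show "induced F C \<in> spanning_trees C (induced E C)"
        "induced F (V - C) \<in> spanning_trees (V - C) (induced E (V - C))"
        using ac su con con' by (auto simp: spanning_trees_def)
    qed
    show "\<forall>F\<in>separating_two_forests V E u v. (\<lambda>(C, A, B). A \<union> B) ({w \<in> V. reach F u w},
        induced F {w \<in> V. reach F u w}, induced F (V - {w \<in> V. reach F u w})) = F"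
      using sep(1)[OF _ refl] by simp
    show "(\<lambda>F. ({w \<in> V. reach F u w}, induced F {w \<in> V. reach F u w},
        induced F (V - {w \<in> V. reach F u w}))) ` separating_two_forests V E u v \<subseteq> Sigma ?I ?P"
      by (rule image_subsetI) (use sep(2-4)[OF _ refl] in simp)
  qed
  then have "card (separating_two_forests V E u v) = card (Sigma ?I ?P)"
    by (rule bij_betw_same_card[symmetric])
  also have "\<dots> = (\<Sum>C\<in>?I. card (?P C))"
  proof (rule card_SigmaI)
    show "finite ?I" using fV(1) by simp
    have "finite (induced E S)" for S using fV(2) by (auto simp: induced_def)
    then show "\<forall>C\<in>?I. finite (?P C)" by (auto intro: finite_spanning_trees)
  qed
  finally show ?thesis by (simp add: card_cartesian_product)
qed

section \<open>Isolated and pendant vertices\<close>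

lemma spanning_trees_singleton: "spanning_trees {x} {} = {{}}"
proof -
  have "acyclic_graph ({} :: 'a set set)" by (simp add: acyclic_graph_iff)
  then show ?thesis
    by (auto simp: spanning_trees_def connected_graph_def joined_def)
qed

lemma num_trees_eq_0_if_isolated:
  assumes "simple_graph V E" "x \<notin> V" "C \<subseteq> insert x V" "x \<in> C" "C \<noteq> {x}"
  shows "num_trees C (induced E C) = 0"
proof (rule ccontr)
  assume nz: "num_trees C (induced E C) \<noteq> 0"
  obtain w where w: "w \<in> C" "w \<noteq> x" using assms by auto
  have "reach (induced E C) x w" using connected_if_num_trees[OF nz] assms w by auto
  then have "w \<in> {x}"
    by (rule reach_closed)
      (use simple_graphD(3)[OF assms(1)] assms(2) in \<open>auto simp: induced_def adjacent_def\<close>)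
  with w show False by simp
qed

text \<open>While x is isolated there is no spanning tree, so \<open>num_trees_insert\<close> leaves
  only the forests separating x from u. In the sum over the component of x only \<open>{x}\<close>
  survives, with complement \<open>V\<close>.\<close>

lemma num_trees_pendant:
  assumes "simple_graph V E" "x \<notin> V" "u \<in> V"
  shows "num_trees (insert x V) (insert {x, u} E) = num_trees V E"
proof -
  let ?V = "insert x V"
  have sg: "simple_graph ?V E"
    by (rule simple_graph_mono[OF assms(1)]) (use simple_graphD(1)[OF assms(1)] in auto)
  have nE: "{x, u} \<notin> E" using simple_graphD(4)[OF assms(1)] assms(2) by auto
  have E: "induced E S = E" if "V \<subseteq> S" for S
    using simple_graphD(4)[OF assms(1)] that by (auto simp: induced_def)
  have "num_trees ?V (insert {x, u} E) = num_trees ?V E + card (separating_two_forests ?V E x u)"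
    using assms nE by (intro num_trees_insert[OF sg]) auto
  also have "num_trees ?V E = 0"
  proof -
    have "?V \<noteq> {x}" using assms(2,3) by auto
    then show ?thesis
      using num_trees_eq_0_if_isolated[OF assms(1,2), of ?V] E[of ?V] by (simp add: subset_insertI)
  qed
  also have "card (separating_two_forests ?V E x u) =
    (\<Sum>C | C \<subseteq> ?V \<and> x \<in> C \<and> u \<notin> C.
       num_trees C (induced E C) * num_trees (?V - C) (induced E (?V - C)))"
    using assms by (intro card_separating_two_forests[OF sg]) auto
  also have "\<dots> = (\<Sum>C\<in>{{x}}.
       num_trees C (induced E C) * num_trees (?V - C) (induced E (?V - C)))"
    using assms simple_graphD(1)[OF sg] num_trees_eq_0_if_isolated[OF assms(1,2)]
    by (intro sum.mono_neutral_right) auto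
  also have "\<dots> = num_trees {x} (induced E {x}) * num_trees V (induced E V)"
    using assms(2) by simp
  also have "induced E {x} = {}"
    using assms(1,2) by (auto simp: simple_graph_def induced_def)
  finally show ?thesis by (simp add: spanning_trees_singleton E)
qed

subsection \<open>Paths, fans and wheels on lists of rim vertices\<close>

text \<open>The rim is a list, so that arcs are contiguous sublists, reflection is
  \<open>rev\<close> and rotation exchanges the two halves of an append.\<close>

fun path_edges :: "'a list \<Rightarrow> 'a set set" where
  "path_edges (x # y # zs) = insert {x, y} (path_edges (y # zs))"
| "path_edges _ = {}"

definition fan_edges :: "'a \<Rightarrow> 'a list \<Rightarrow> 'a set set" where
  "fan_edges h xs = (\<lambda>x. {x, h}) ` set xs \<union> path_edges xs"

definition cyclic_wheel_edges :: "'a \<Rightarrow> 'a list \<Rightarrow> 'a set set" where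
  "cyclic_wheel_edges h xs = insert {last xs, hd xs} (fan_edges h xs)"

lemma path_edges_Cons: "xs \<noteq> [] \<Longrightarrow> path_edges (x # xs) = insert {x, hd xs} (path_edges xs)"
  by (cases xs) auto

lemma path_edges_append:
  "path_edges (xs @ ys) = path_edges xs \<union> path_edges ys \<union>
     (if xs = [] \<or> ys = [] then {} else {{last xs, hd ys}})"
proof (induction xs rule: path_edges.induct)
  case ("2_2" x)
  then show ?case by (cases ys) auto
qed auto

lemma path_edges_rev: "path_edges (rev xs) = path_edges xs"
proof (induction xs rule: path_edges.induct)
  case (1 x y zs)
  have "path_edges (rev (x # y # zs)) = insert {y, x} (path_edges (rev (y # zs)))"
    using path_edges_append[of "rev (y # zs)" "[x]"] by simp
  then show ?case by (simp only: 1 path_edges.simps insert_commute[of y x])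
qed auto

lemma path_edges_mem: "e \<in> path_edges xs \<Longrightarrow> e \<subseteq> set xs \<and> e \<noteq> {}"
  by (induction xs rule: path_edges.induct) auto

lemma fan_edges_rev: "fan_edges h (rev xs) = fan_edges h xs"
  by (simp add: fan_edges_def path_edges_rev)

text \<open>The edge between \<open>last xs\<close> and \<open>hd ys\<close> and the edge between
  \<open>last ys\<close> and \<open>hd xs\<close> exchange roles: one is a path edge and the other
  closes the rim.\<close>

lemma cyclic_wheel_edges_rotate:
  "cyclic_wheel_edges h (xs @ ys) = cyclic_wheel_edges h (ys @ xs)"
proof (cases "xs = [] \<or> ys = []")
  case False
  then show ?thesis
    unfolding cyclic_wheel_edges_def fan_edges_def path_edges_append by simp blast
qed auto

lemma simple_graph_insert:
  "simple_graph V E \<Longrightarrow> u \<in> V \<Longrightarrow> v \<in> V \<Longrightarrow> u \<noteq> v \<Longrightarrow> simple_graph V (insert {u, v} E)"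
  unfolding simple_graph_def by (metis insertE)

lemma simple_graph_path: "distinct xs \<Longrightarrow> simple_graph (set xs) (path_edges xs)"
proof (induction xs rule: path_edges.induct)
  case (1 x y zs)
  then have "simple_graph (set (y # zs)) (path_edges (y # zs))" by simp
  then have "simple_graph (set (x # y # zs)) (path_edges (y # zs))"
    by (rule simple_graph_mono) auto
  then have "simple_graph (set (x # y # zs)) (insert {x, y} (path_edges (y # zs)))"
    using 1(2) by (intro simple_graph_insert) auto
  then show ?case by simp
qed (auto simp: simple_graph_def)

lemma simple_graph_fan:
  assumes "distinct xs" "h \<notin> set xs"
  shows "simple_graph (insert h (set xs)) (fan_edges h xs)"
proof -
  have "simple_graph (insert h (set xs)) (path_edges xs)"
    using simple_graph_path[OF assms(1)] by (rule simple_graph_mono) auto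
  with assms(2) show ?thesis by (auto simp: simple_graph_def fan_edges_def)
qed

lemma simple_graph_cyclic_wheel:
  assumes "distinct xs" "h \<notin> set xs" "length xs \<ge> 2"
  shows "simple_graph (insert h (set xs)) (cyclic_wheel_edges h xs)"
proof -
  have "xs \<noteq> []" using assms by auto
  moreover from this have "last xs \<noteq> hd xs"
    using assms by (auto simp: hd_conv_nth last_conv_nth nth_eq_iff_index_eq)
  ultimately show ?thesis
    using simple_graph_fan[OF assms(1,2)] last_in_set[of xs] hd_in_set[of xs]
    unfolding cyclic_wheel_edges_def by (intro simple_graph_insert) auto
qed

text \<open>\<open>S\<close> may reach beyond the path, for instance to the hub. Path edges outside
  \<open>qs\<close> have an end in \<open>ps\<close> or \<open>rs\<close>, where \<open>S\<close>
  has no vertex.\<close>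

lemma induced_path_edges:
  assumes "distinct (ps @ qs @ rs)" "S \<inter> set (ps @ qs @ rs) = set qs"
  shows "induced (path_edges (ps @ qs @ rs)) S = path_edges qs"
proof -
  have 1: "\<not> e \<subseteq> S" if "e \<in> path_edges ps \<or> e \<in> path_edges rs" for e
  proof -
    have "e \<noteq> {}" "e \<subseteq> set ps \<or> e \<subseteq> set rs" using that path_edges_mem[of e] by auto
    moreover have "S \<inter> set ps = {}" "S \<inter> set rs = {}" using assms by (auto 0 3)
    ultimately show ?thesis by blast
  qed
  have 2: "e \<subseteq> S" if "e \<in> path_edges qs" for e
    using path_edges_mem[OF that] assms(2) by blast
  have 3: "ps \<noteq> [] \<Longrightarrow> last ps \<notin> S" "rs \<noteq> [] \<Longrightarrow> hd rs \<notin> S"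
  proof -
    have "S \<inter> set ps = {}" "S \<inter> set rs = {}" using assms by (auto 0 3)
    then show "ps \<noteq> [] \<Longrightarrow> last ps \<notin> S" "rs \<noteq> [] \<Longrightarrow> hd rs \<notin> S"
      using last_in_set[of ps] hd_in_set[of rs] by blast+
  qed
  show ?thesis
    using 1 2 3 by (auto simp: induced_def path_edges_append split: if_splits)
qed

lemma induced_fan_edges:
  assumes "distinct (ps @ qs @ rs)" "h \<notin> set (ps @ qs @ rs)"
  shows "induced (fan_edges h (ps @ qs @ rs)) (insert h (set qs)) = fan_edges h qs"
    and "induced (fan_edges h (ps @ qs @ rs)) (set qs) = path_edges qs"
proof -
  have *: "induced (fan_edges h xs) S = induced ((\<lambda>x. {x, h}) ` set xs) S \<union> induced (path_edges xs) S"
    for S xs by (auto simp: induced_def fan_edges_def)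
  have "induced (path_edges (ps @ qs @ rs)) (insert h (set qs)) = path_edges qs"
    using assms by (intro induced_path_edges) auto
  moreover have "induced ((\<lambda>x. {x, h}) ` set (ps @ qs @ rs)) (insert h (set qs)) = (\<lambda>x. {x, h}) ` set qs"
    using assms by (auto simp: induced_def)
  ultimately show "induced (fan_edges h (ps @ qs @ rs)) (insert h (set qs)) = fan_edges h qs"
    unfolding * by (simp add: fan_edges_def)
  have "induced (path_edges (ps @ qs @ rs)) (set qs) = path_edges qs"
    using assms by (intro induced_path_edges) auto
  moreover have "induced ((\<lambda>x. {x, h}) ` set (ps @ qs @ rs)) (set qs) = {}"
    using assms by (auto simp: induced_def)
  ultimately show "induced (fan_edges h (ps @ qs @ rs)) (set qs) = path_edges qs"
    unfolding * by simp
qed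

text \<open>Removing a nonempty arc opens the rim: the closing edge contains \<open>hd ps\<close>,
  so what remains is a fan or a path.\<close>

lemma induced_cyclic_wheel_edges:
  assumes "distinct (ps @ qs)" "h \<notin> set (ps @ qs)" "ps \<noteq> []" "qs \<noteq> []"
  shows "induced (cyclic_wheel_edges h (ps @ qs)) (insert h (set qs)) = fan_edges h qs"
    and "induced (cyclic_wheel_edges h (ps @ qs)) (set qs) = path_edges qs"
proof -
  have "set ps \<inter> insert h (set qs) = {}" using assms by auto
  then have "hd ps \<notin> insert h (set qs)" using hd_in_set[OF assms(3)] by blast
  then have *: "induced (cyclic_wheel_edges h (ps @ qs)) S = induced (fan_edges h (ps @ qs)) S"
    if "S \<subseteq> insert h (set qs)" for S
    using that assms(3) by (auto simp: induced_def cyclic_wheel_edges_def)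
  show "induced (cyclic_wheel_edges h (ps @ qs)) (insert h (set qs)) = fan_edges h qs"
    using * induced_fan_edges(1)[of ps qs "[]" h] assms by simp
  have "induced (cyclic_wheel_edges h (ps @ qs)) (set qs) = induced (fan_edges h (ps @ qs)) (set qs)"
    by (rule *) auto
  then show "induced (cyclic_wheel_edges h (ps @ qs)) (set qs) = path_edges qs"
    using induced_fan_edges(2)[of ps qs "[]" h] assms by simp
qed

section \<open>Connected vertex sets of a path\<close>

lemma num_trees_path: "distinct xs \<Longrightarrow> xs \<noteq> [] \<Longrightarrow> num_trees (set xs) (path_edges xs) = 1"
proof (induction xs rule: path_edges.induct)
  case (1 x y zs)
  then show ?case
    using num_trees_pendant[OF simple_graph_path, of "y # zs" x y] by simp
qed (auto simp: spanning_trees_singleton)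

text \<open>A connected set of path vertices is an interval. The intervals around i are indexed by
  the number \<open>s\<close> of vertices dropped on the left and the number \<open>t\<close> kept
  on the right.\<close>

lemma connected_in_path:
  assumes "distinct (xs @ i # ys)" "C \<subseteq> set (xs @ i # ys)" "i \<in> C"
    and "\<And>w. w \<in> C \<Longrightarrow> reach (induced (path_edges (xs @ i # ys)) C) i w"
  obtains s t where "s \<le> length xs" "t \<le> length ys" "C = set (drop s xs @ i # take t ys)"
proof -
  let ?P = "\<lambda>x. x \<in> C"
  \<comment> \<open>The candidate interval \<open>qs\<close> extends i in both directions as long as
    the vertices stay in \<open>C\<close>; its outer neighbours, where they exist, are therefore
    outside \<open>C\<close>.\<close>
  define s where "s = length xs - length (takeWhile ?P (rev xs))"
  define t where "t = length (takeWhile ?P ys)"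
  define ps qs rs where "ps = take s xs" and "qs = drop s xs @ i # take t ys" and "rs = drop t ys"
  have split: "xs @ i # ys = ps @ qs @ rs" by (simp add: ps_def qs_def rs_def)
  have drop: "drop s xs = rev (takeWhile ?P (rev xs))"
    by (metis length_rev rev_rev_ident s_def takeWhile_eq_take rev_take)
  have take: "take t ys = takeWhile ?P ys" by (simp add: t_def takeWhile_eq_take[symmetric])
  have ps: "ps = rev (dropWhile ?P (rev xs))"
    by (metis append_same_eq append_take_drop_id drop ps_def rev_append rev_rev_ident
        takeWhile_dropWhile_id)
  have rs: "rs = dropWhile ?P ys" by (simp add: rs_def t_def dropWhile_eq_drop)
  have last: "ps \<noteq> [] \<Longrightarrow> last ps \<notin> C"
    using hd_dropWhile[of ?P "rev xs"] by (simp add: ps last_rev del: dropWhile_eq_Nil_conv)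
  have hd: "rs \<noteq> [] \<Longrightarrow> hd rs \<notin> C"
    unfolding rs using hd_dropWhile[of ?P ys] by (simp del: dropWhile_eq_Nil_conv)
  have qsC: "set qs \<subseteq> C"
    unfolding qs_def drop take using assms(3) by (auto dest: set_takeWhileD)
  have "C \<subseteq> set qs"
  proof
    fix w assume "w \<in> C"
    then have "reach (induced (path_edges (xs @ i # ys)) C) i w" by (rule assms(4))
    then show "w \<in> set qs"
    proof (rule reach_closed)
      show "i \<in> set qs" by (simp add: qs_def)
      fix x y assume x: "x \<in> set qs" and "adjacent (induced (path_edges (xs @ i # ys)) C) x y"
      then have e: "{x, y} \<in> path_edges (ps @ qs @ rs)" "y \<in> C"
        unfolding split by (auto simp: adjacent_def induced_def)
      have d: "distinct (ps @ qs @ rs)" using assms(1) split by simp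
      have "qs \<noteq> []" by (simp add: qs_def)
      \<comment> \<open>Only the last two kinds of edge lead out of \<open>qs\<close>, and each
        would need an outer neighbour of \<open>qs\<close> to be in \<open>C\<close>.\<close>
      with e(1) consider "{x, y} \<in> path_edges ps" | "{x, y} \<in> path_edges qs" | "{x, y} \<in> path_edges rs"
        | "ps \<noteq> []" "{x, y} = {last ps, hd qs}" | "rs \<noteq> []" "{x, y} = {last qs, hd rs}"
        by (auto simp: path_edges_append split: if_splits)
      then show "y \<in> set qs"
      proof cases
        case 4
        then show ?thesis
          using last e(2) x d hd_in_set[OF \<open>qs \<noteq> []\<close>] by (auto simp: doubleton_eq_iff)
      next
        case 5
        then show ?thesis
          using hd e(2) x d last_in_set[OF \<open>qs \<noteq> []\<close>] by (auto simp: doubleton_eq_iff)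
      qed (use path_edges_mem[of "{x, y}"] d x in auto)
    qed
  qed
  with qsC have "C = set (drop s xs @ i # take t ys)" by (auto simp: qs_def)
  moreover have "s \<le> length xs" "t \<le> length ys"
    by (simp_all add: s_def t_def length_takeWhile_le)
  ultimately show ?thesis using that by blast
qed

text \<open>Only intervals through i have a spanning tree, and each has exactly one, so the tree
  factor disappears. \<open>E\<close> may carry further edges off the list, such as spokes, and
  \<open>g\<close> later counts the trees of the complement.\<close>

lemma sum_connected_in_path:
  fixes g :: "'a set \<Rightarrow> nat"
  assumes d: "distinct (xs @ i # ys)"
    and E: "induced E (set (xs @ i # ys)) = path_edges (xs @ i # ys)"
  shows "(\<Sum>C | C \<subseteq> set (xs @ i # ys) \<and> i \<in> C. num_trees C (induced E C) * g C) =
    (\<Sum>s\<le>length xs. \<Sum>t\<le>length ys. g (set (drop s xs @ i # take t ys)))"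
proof -
  let ?zs = "xs @ i # ys" and ?I = "{..length xs} \<times> {..length ys}"
  let ?c = "\<lambda>(s, t). set (drop s xs @ i # take t ys)"
  have ind: "induced E C = induced (path_edges ?zs) C" if "C \<subseteq> set ?zs" for C
    unfolding E[symmetric] using that by (auto simp: induced_def)
  have sub: "?c p \<subseteq> set ?zs" for p
    by (cases p) (auto dest: in_set_takeD in_set_dropD)
  have inj: "inj_on ?c ?I"
  proof (rule inj_onI, clarify)
    fix s t s' t'
    assume le: "s \<le> length xs" "t \<le> length ys" "s' \<le> length xs" "t' \<le> length ys"
      and eq: "set (drop s xs @ i # take t ys) = set (drop s' xs @ i # take t' ys)"
    \<comment> \<open>The interval determines its parts on either side of i; by distinctness their
      lengths give back \<open>s\<close> and \<open>t\<close>.\<close>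
    have x: "set (drop a xs @ i # take b ys) \<inter> set xs = set (drop a xs)"
      and y: "set (drop a xs @ i # take b ys) \<inter> set ys = set (take b ys)" for a b
      using d by (auto dest: in_set_takeD in_set_dropD)
    have "set (drop s xs) = set (drop s' xs)" using eq x by metis
    then have "length (drop s xs) = length (drop s' xs)"
      using d by (metis distinct_append distinct_card distinct_drop)
    moreover have "set (take t ys) = set (take t' ys)" using eq y by metis
    then have "length (take t ys) = length (take t' ys)"
      using d by (metis distinct.simps(2) distinct_append distinct_card distinct_take)
    ultimately show "s = s' \<and> t = t'" using le by auto
  qed
  have one: "num_trees (?c p) (induced E (?c p)) = 1" for p
  proof -
    obtain s t where p: "p = (s, t)" by (cases p)
    let ?qs = "drop s xs @ i # take t ys"
    have zs: "?zs = take s xs @ ?qs @ drop t ys" by simp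
    have "induced (path_edges (take s xs @ ?qs @ drop t ys)) (set ?qs) = path_edges ?qs"
      using d sub[of p] p unfolding zs by (intro induced_path_edges) auto
    then have "induced E (?c p) = path_edges ?qs"
      using ind[OF sub[of p]] unfolding zs[symmetric] p by simp
    moreover have "distinct ?qs" using d unfolding zs by (simp only: distinct_append)
    ultimately show ?thesis using num_trees_path[of ?qs] p by simp
  qed
  have "(\<Sum>C | C \<subseteq> set ?zs \<and> i \<in> C. num_trees C (induced E C) * g C) =
    (\<Sum>C\<in>?c ` ?I. num_trees C (induced E C) * g C)"
  proof (rule sum.mono_neutral_right)
    show "?c ` ?I \<subseteq> {C. C \<subseteq> set ?zs \<and> i \<in> C}" using sub by auto
    show "\<forall>C\<in>{C. C \<subseteq> set ?zs \<and> i \<in> C} - ?c ` ?I. num_trees C (induced E C) * g C = 0"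
    proof (rule ballI, rule ccontr)
      fix C assume C: "C \<in> {C. C \<subseteq> set ?zs \<and> i \<in> C} - ?c ` ?I"
        and "num_trees C (induced E C) * g C \<noteq> 0"
      then have "num_trees C (induced E C) \<noteq> 0" by simp
      then have "reach (induced (path_edges ?zs) C) i w" if "w \<in> C" for w
        using connected_if_num_trees[of C "induced E C" i w] that C ind[of C] by simp
      then obtain s t where "s \<le> length xs" "t \<le> length ys" "C = set (drop s xs @ i # take t ys)"
        using connected_in_path[OF d, of C] C by blast
      then show False using C by auto
    qed
  qed (simp add: finite_Collect_conjI)
  also have "\<dots> = (\<Sum>p\<in>?I. g (?c p))"
    using inj one by (simp add: sum.reindex)
  also have "\<dots> = (\<Sum>s\<le>length xs. \<Sum>t\<le>length ys. g (set (drop s xs @ i # take t ys)))"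
    by (simp add: sum.cartesian_product case_prod_unfold)
  finally show ?thesis .
qed

subsection \<open>Fibonacci and Lucas numbers\<close>

lemma fib_add_2: "fib (m + 2) = fib (m + 1) + fib m"
  by simp

lemma lucas_add_2: "lucas (m + 2) = lucas (m + 1) + lucas m"
  by simp

text \<open>Telescoping: each even-index term lifts the odd-index number before it to the next odd
  index. The offset \<open>s\<close> is needed for the inner sum of
  \<open>sum_sum_fib_even\<close>.\<close>

lemma sum_fib_even: "(\<Sum>t\<le>a. fib (2 * (s + t + 1))) + fib (2 * s + 1) = fib (2 * (s + a) + 3)"
proof (induction a)
  case 0
  show ?case using fib_add_2[of "2 * s + 1"] by (simp del: fib.simps add: numeral_3_eq_3)
next
  case (Suc a)
  have "2 * (s + Suc a + 1) = 2 * (s + a) + 3 + 1" "2 * (s + Suc a) + 3 = 2 * (s + a) + 3 + 2"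
    by simp_all
  then show ?case
    unfolding sum.atMost_Suc using Suc fib_add_2[of "2 * (s + a) + 3"] by (simp only:)
qed

lemma sum_fib_odd: "(\<Sum>s\<le>b. fib (2 * (s + c) + 1)) + fib (2 * c) = fib (2 * (b + c) + 2)"
proof (induction b)
  case 0
  show ?case using fib_add_2[of "2 * c"] by (simp del: fib.simps)
next
  case (Suc a)
  then show ?case using fib_add_2[of "2 * (a + c) + 2"] by (simp del: fib.simps add: algebra_simps)
qed

text \<open>Even-index Fibonacci and Lucas numbers obey the same recurrence; integers allow the
  subtraction.\<close>

lemma fib_even_rec: "int (fib (2 * (m + 2))) = 3 * int (fib (2 * (m + 1))) - int (fib (2 * m))"
  using fib_add_2[of "2 * m"] fib_add_2[of "2 * m + 1"] fib_add_2[of "2 * m + 2"]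
  by (simp del: fib.simps add: algebra_simps)

lemma lucas_even_rec:
  "int (lucas (2 * (m + 2))) = 3 * int (lucas (2 * (m + 1))) - int (lucas (2 * m))"
  using lucas_add_2[of "2 * m"] lucas_add_2[of "2 * m + 1"] lucas_add_2[of "2 * m + 2"]
  by (simp del: lucas.simps add: algebra_simps)

lemma lucas_Suc: "lucas (Suc m) = fib (Suc m) + 2 * fib m"
  by (induction m rule: fib.induct) auto

text \<open>For fixed k both sides satisfy the recurrence of \<open>fib_even_rec\<close> in d, so d
  = 0 and d = 1 suffice; both sides vanish at d = 0.\<close>

lemma fib_lucas_even_diff:
  "int (fib (2 * (k + d))) * int (lucas (2 * k)) - int (fib (2 * k)) * int (lucas (2 * (k + d))) =
     2 * int (fib (2 * d))"
proof (induction d rule: fib.induct)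
  \<comment> \<open>For d = 1 the left side is the Casoratian of two solutions of one recurrence
    with last coefficient -1, hence constant in k.\<close>
  case 2
  show ?case
  proof (induction k)
    case 0
    then show ?case by (simp add: numeral_2_eq_2)
  next
    case (Suc k)
    have "int (fib (2 * (Suc k + 1))) = 3 * int (fib (2 * (k + 1))) - int (fib (2 * k))"
      "int (lucas (2 * (Suc k + 1))) = 3 * int (lucas (2 * (k + 1))) - int (lucas (2 * k))"
      using fib_even_rec[of k] lucas_even_rec[of k] by (simp_all del: fib.simps lucas.simps)
    moreover have "f2 * l1 - f1 * l2 = c"
      if "f1 * l0 - f0 * l1 = c" "f2 = 3 * f1 - f0" "l2 = 3 * l1 - l0" for f0 f1 f2 l0 l1 l2 c :: int
      unfolding that(2,3) that(1)[symmetric] by (simp add: algebra_simps)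
    ultimately show ?case using Suc by (simp del: fib.simps lucas.simps)
  qed
next
  case (3 d)
  have "int (fib (2 * (k + Suc (Suc d)))) = 3 * int (fib (2 * (k + Suc d))) - int (fib (2 * (k + d)))"
    "int (lucas (2 * (k + Suc (Suc d)))) = 3 * int (lucas (2 * (k + Suc d))) - int (lucas (2 * (k + d)))"
    "int (fib (2 * Suc (Suc d))) = 3 * int (fib (2 * Suc d)) - int (fib (2 * d))"
    using fib_even_rec[of "k + d"] lucas_even_rec[of "k + d"] fib_even_rec[of d]
    by (simp_all del: fib.simps lucas.simps)
  then show ?case
    using 3 by (simp only:) (simp only: algebra_simps)
qed simp

text \<open>By \<open>sum_fib_even\<close> each inner sum is a difference of two odd-index numbers;
  \<open>sum_fib_odd\<close> then sums each kind over s. Subtracted terms stand on the left to stay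
  within the naturals.\<close>

lemma sum_sum_fib_even:
  "(\<Sum>s\<le>b. \<Sum>t\<le>a. fib (2 * (s + t + 1))) + fib (2 * (a + 1)) + fib (2 * (b + 1)) =
     fib (2 * (a + b + 2))"
proof -
  have "(\<Sum>s\<le>b. \<Sum>t\<le>a. fib (2 * (s + t + 1))) + (\<Sum>s\<le>b. fib (2 * (s + 0) + 1)) =
      (\<Sum>s\<le>b. fib (2 * (s + (a + 1)) + 1))"
    unfolding sum.distrib[symmetric]
  proof (intro sum.cong refl)
    fix s
    have "2 * (s + (a + 1)) + 1 = 2 * (s + a) + 3" "2 * (s + 0) + 1 = 2 * s + 1" by simp_all
    then show "(\<Sum>t\<le>a. fib (2 * (s + t + 1))) + fib (2 * (s + 0) + 1) = fib (2 * (s + (a + 1)) + 1)"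
      using sum_fib_even[of s a] by (simp only:)
  qed
  moreover have "2 * (b + 0) + 2 = 2 * (b + 1)" "2 * (b + (a + 1)) + 2 = 2 * (a + b + 2)" by simp_all
  ultimately show ?thesis
    using sum_fib_odd[of 0 b] sum_fib_odd[of "a + 1" b]
    by (simp del: fib.simps add: fib.simps(1) algebra_simps)
qed

subsection \<open>Counting in fans and wheels\<close>

lemma insert_set_Diff_prefix:
  assumes "zs = xs @ ys" "distinct zs" "h \<notin> set zs"
  shows "insert h (set zs) - set xs = insert h (set ys)"
  using assms by auto

text \<open>Each two-component forest has exactly one component avoiding the hub \<open>h\<close>; the two sums
  record whether that component contains \<open>u\<close> or \<open>v\<close>.\<close>

lemma card_separating_two_forests_hub:
  assumes "simple_graph (insert h W) E" "h \<notin> W" "u \<in> W" "v \<in> W"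
  defines "g \<equiv> \<lambda>C. num_trees C (induced E C)"
  shows "card (separating_two_forests (insert h W) E u v) =
    (\<Sum>C | C \<subseteq> W - {v} \<and> u \<in> C. g C * g (insert h W - C)) +
    (\<Sum>C | C \<subseteq> W - {u} \<and> v \<in> C. g C * g (insert h W - C))"
proof -
  let ?V = "insert h W"
  let ?f = "\<lambda>C. g C * g (?V - C)"
  let ?A = "{C. C \<subseteq> W - {v} \<and> u \<in> C}" and ?B = "{C. C \<subseteq> ?V \<and> u \<in> C \<and> v \<notin> C \<and> h \<in> C}"
  have fin: "finite W" using simple_graphD(1)[OF assms(1)] by simp
  have "{C. C \<subseteq> ?V \<and> u \<in> C \<and> v \<notin> C} = ?A \<union> ?B" using assms(2) by auto
  then have "card (separating_two_forests ?V E u v) = sum ?f (?A \<union> ?B)"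
    using card_separating_two_forests[OF assms(1), of u v] assms(3,4) by (simp add: g_def)
  also have "\<dots> = sum ?f ?A + sum ?f ?B"
    using fin assms(2) by (intro sum.union_disjoint) auto
  also have "sum ?f ?B = (\<Sum>C | C \<subseteq> W - {u} \<and> v \<in> C. ?f C)"
  \<comment> \<open>Taking complements replaces the component of u, when it holds the hub, by the
    component of v; the product of tree counts is symmetric.\<close>
  proof (rule sum.reindex_bij_witness[where i = "\<lambda>C. ?V - C" and j = "\<lambda>C. ?V - C"])
    fix C assume "C \<in> ?B"
    then have "?V - (?V - C) = C" by auto
    then show "?f (?V - C) = ?f C" by simp
  qed (use assms(2-4) in auto)
  finally show ?thesis .
qed

text \<open>The spoke at the end vertex x is taken out. What remains is a smaller fan with x
  pendant, and the forests separating x from h are given by the arcs starting at x, each leaving a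
  smaller fan. The empty rim has one tree, whereas \<open>fib 0\<close> is 0, hence the case
  split.\<close>

lemma num_trees_fan:
  fixes h :: 'a
  assumes "distinct xs" "h \<notin> set xs"
  shows "num_trees (insert h (set xs)) (fan_edges h xs) =
    (if xs = [] then 1 else fib (2 * length xs))"
  using assms
proof (induction "length xs" arbitrary: xs rule: less_induct)
  case less
  consider "xs = []" | x where "xs = [x]" | x ys where "xs = x # ys" "ys \<noteq> []"
    by (metis neq_Nil_conv)
  then show ?case
  proof cases
    case 1
    then show ?thesis by (simp add: fan_edges_def spanning_trees_singleton)
  next
    case 2
    then have "num_trees (insert x {h}) (insert {x, h} {}) = num_trees {h} {}"
      using less.prems by (intro num_trees_pendant) (auto simp: simple_graph_def)
    with 2 show ?thesis
      by (simp add: fan_edges_def spanning_trees_singleton insert_commute numeral_2_eq_2)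
  next
    case (3 x ys)
    \<comment> \<open>\<open>E\<close> is the fan on \<open>x # ys\<close> without the spoke
      xh.\<close>
    define V E where "V = insert x (insert h (set ys))" and "E = insert {x, hd ys} (fan_edges h ys)"
    let ?g = "\<lambda>C. num_trees C (induced E C)"
    have d: "distinct (x # ys)" "h \<notin> set (x # ys)" using less.prems 3 by auto
    have fan: "fan_edges h (x # ys) = insert {x, h} E"
      using 3(2) by (auto simp: E_def fan_edges_def path_edges_Cons)
    have V: "V = insert h (set (x # ys))" by (auto simp: V_def)
    have sg0: "simple_graph (insert h (set ys)) (fan_edges h ys)"
      using simple_graph_fan d by auto
    have sg: "simple_graph V E"
      using simple_graph_mono[OF simple_graph_fan[OF d], of E V] by (auto simp: V fan)
    have nE: "{x, h} \<notin> E"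
    proof -
      have "{x, h} \<notin> fan_edges h ys" using simple_graphD(4)[OF sg0] d by auto
      moreover have "hd ys \<noteq> h" using d 3(2) hd_in_set by fastforce
      ultimately show ?thesis using d by (auto simp: E_def doubleton_eq_iff)
    qed
    have IH: "num_trees (insert h (set zs)) (fan_edges h zs) =
        (if zs = [] then 1 else fib (2 * length zs))"
      if "length zs \<le> length ys" "distinct zs" "h \<notin> set zs" for zs
      using less.hyps[of zs] that 3 by simp
    have "num_trees V (insert {x, h} E) = num_trees V E + card (separating_two_forests V E x h)"
      using d nE by (intro num_trees_insert[OF sg]) (auto simp: V_def)
    also have "num_trees V E = fib (2 * length ys)"
      using num_trees_pendant[OF sg0, of x "hd ys"] IH[of ys] d 3(2) by (auto simp: V_def E_def)
    also have "card (separating_two_forests V E x h) =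
        (\<Sum>C | C \<subseteq> V \<and> x \<in> C \<and> h \<notin> C. ?g C * ?g (V - C))"
      by (intro card_separating_two_forests[OF sg]) (auto simp: V_def)
    also have "{C. C \<subseteq> V \<and> x \<in> C \<and> h \<notin> C} = {C. C \<subseteq> set ([] @ x # ys) \<and> x \<in> C}"
      using d by (auto simp: V)
    also have "(\<Sum>C | C \<subseteq> set ([] @ x # ys) \<and> x \<in> C. ?g C * ?g (V - C)) =
        (\<Sum>s\<le>length ([] :: 'a list). \<Sum>t\<le>length ys. ?g (V - set (drop s [] @ x # take t ys)))"
    proof (rule sum_connected_in_path)
      have "induced E (set (x # ys)) = induced (fan_edges h (x # ys)) (set (x # ys))"
        using d unfolding fan by (auto simp: induced_def)
      then show "induced E (set ([] @ x # ys)) = path_edges ([] @ x # ys)"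
        using induced_fan_edges(2)[of "[]" "x # ys" "[]" h] d by simp
    qed (use d in auto)
    also have "\<dots> = (\<Sum>t\<le>length ys. ?g (V - set (x # take t ys)))" by simp
    also have "\<dots> = (\<Sum>t\<le>length ys. if length ys - t = 0 then 1 else fib (2 * (length ys - t)))"
    proof (rule sum.cong)
      fix t assume "t \<in> {..length ys}"
      let ?zs = "drop t ys"
      have split: "x # ys = (x # take t ys) @ ?zs @ []" by simp
      have d': "distinct ((x # take t ys) @ ?zs @ [])" "h \<notin> set ((x # take t ys) @ ?zs @ [])"
        using d unfolding split[symmetric] by auto
      have "V - set (x # take t ys) = insert h (set ?zs)"
        unfolding V using d by (intro insert_set_Diff_prefix) auto
      moreover have "induced E (insert h (set ?zs)) = fan_edges h ?zs"
      proof -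
        have "x \<notin> insert h (set ?zs)" using d by (auto dest: in_set_dropD)
        then have "induced E (insert h (set ?zs)) =
            induced (fan_edges h (x # ys)) (insert h (set ?zs))"
          unfolding fan by (auto simp: induced_def)
        then show ?thesis using induced_fan_edges(1)[OF d'] unfolding split[symmetric] by simp
      qed
      moreover have "num_trees (insert h (set ?zs)) (fan_edges h ?zs) =
          (if ?zs = [] then 1 else fib (2 * length ?zs))"
        using d by (intro IH) (auto dest: in_set_dropD)
      ultimately show "?g (V - set (x # take t ys)) =
          (if length ys - t = 0 then 1 else fib (2 * (length ys - t)))"
        by simp
    qed simp
    \<comment> \<open>Reindexing by the number b of rim vertices left. The value 1 at b = 0 is also
      \<open>fib 1\<close>, which starts the telescoping.\<close>
    also have "\<dots> = (\<Sum>b\<le>length ys. if b = 0 then 1 else fib (2 * b))"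
      by (rule sum.reindex_bij_witness[of _ "\<lambda>t. length ys - t" "\<lambda>t. length ys - t"]) auto
    also have "\<dots> = fib (2 * length ys + 1)"
    proof -
      obtain m where "length ys = Suc m" using 3(2) by (cases ys) auto
      then have "(\<Sum>b\<le>length ys. if b = 0 then 1 else fib (2 * b)) =
          1 + (\<Sum>t\<le>m. fib (2 * (0 + t + 1)))"
        by (simp del: fib.simps(3) sum.atMost_Suc add: sum.atMost_Suc_shift)
      also have "\<dots> = fib (2 * (0 + m) + 3)"
        using sum_fib_even[where s = 0 and a = m] by (simp del: fib.simps(3))
      also have "2 * (0 + m) + 3 = 2 * length ys + 1" using \<open>length ys = Suc m\<close> by simp
      finally show ?thesis .
    qed
    finally show ?thesis using 3 fan V by (simp add: numeral_2_eq_2)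
  qed
qed

text \<open>One of the two sums of \<open>card_separating_two_forests_hub\<close> for the ends x and
  z of a fan. The arcs start at x and stop before z, so the remaining fan always has a rim vertex;
  the added 1 is \<open>fib 1\<close>.\<close>

lemma sum_fan_arcs:
  fixes h :: 'a
  assumes "distinct (x # ys @ [z])" "h \<notin> set (x # ys @ [z])"
  defines "W \<equiv> set (x # ys @ [z])" and "E \<equiv> fan_edges h (x # ys @ [z])"
  defines "g \<equiv> \<lambda>C. num_trees C (induced E C)"
  shows "(\<Sum>C | C \<subseteq> W - {z} \<and> x \<in> C. g C * g (insert h W - C)) + 1 = fib (2 * length ys + 3)"
proof -
  have "W - {z} = set ([] @ x # ys)" using assms(1) by (auto simp: W_def)
  then have "(\<Sum>C | C \<subseteq> W - {z} \<and> x \<in> C. g C * g (insert h W - C)) =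
      (\<Sum>C | C \<subseteq> set ([] @ x # ys) \<and> x \<in> C. g C * g (insert h W - C))"
    by simp
  also have "\<dots> = (\<Sum>s\<le>length ([] :: 'a list). \<Sum>t\<le>length ys. g (insert h W - set (drop s [] @ x # take t ys)))"
    unfolding g_def
  proof (rule sum_connected_in_path)
    show "induced E (set ([] @ x # ys)) = path_edges ([] @ x # ys)"
      using induced_fan_edges(2)[of "[]" "x # ys" "[z]" h] assms(1,2) by (simp add: E_def)
  qed (use assms(1) in auto)
  also have "\<dots> = (\<Sum>t\<le>length ys. g (insert h W - set (x # take t ys)))" by simp
  also have "\<dots> = (\<Sum>t\<le>length ys. fib (2 * (0 + (length ys - t) + 1)))"
  proof (rule sum.cong)
    fix t
    let ?zs = "drop t ys @ [z]"
    have split: "x # ys @ [z] = (x # take t ys) @ ?zs @ []" by simp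
    have d: "distinct ((x # take t ys) @ ?zs @ [])" "h \<notin> set ((x # take t ys) @ ?zs @ [])"
      using assms(1,2) unfolding split[symmetric] by auto
    have "insert h W - set (x # take t ys) = insert h (set ?zs)"
      unfolding W_def using assms(1,2) by (intro insert_set_Diff_prefix) auto
    moreover have "induced E (insert h (set ?zs)) = fan_edges h ?zs"
      using induced_fan_edges(1)[OF d] unfolding split[symmetric] E_def .
    moreover have "num_trees (insert h (set ?zs)) (fan_edges h ?zs) = fib (2 * length ?zs)"
      using assms(1,2) by (subst num_trees_fan) (auto dest: in_set_dropD)
    ultimately show "g (insert h W - set (x # take t ys)) = fib (2 * (0 + (length ys - t) + 1))"
      by (simp add: g_def)
  qed simp
  also have "\<dots> = (\<Sum>t\<le>length ys. fib (2 * (0 + t + 1)))"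
    by (rule sum.reindex_bij_witness[of _ "\<lambda>t. length ys - t" "\<lambda>t. length ys - t"]) auto
  finally show ?thesis using sum_fib_even[where s = 0 and a = "length ys"] by simp
qed

text \<open>The wheel is the fan plus the edge joining its ends, so the forests of the fan
  separating these ends have to be added.\<close>

lemma num_trees_cyclic_wheel:
  assumes "distinct xs" "h \<notin> set xs" "length xs \<ge> 3"
  shows "num_trees (insert h (set xs)) (cyclic_wheel_edges h xs) + 2 = lucas (2 * length xs)"
proof -
  obtain x ys z where xs: "xs = x # ys @ [z]" and "ys \<noteq> []"
  proof -
    obtain x xs' where 1: "xs = x # xs'" using assms(3) by (cases xs) auto
    moreover obtain ys z where "xs' = ys @ [z]"
      using assms(3) 1 by (cases xs' rule: rev_cases) auto
    moreover from calculation have "ys \<noteq> []" using assms(3) by auto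
    ultimately show ?thesis using that[of x ys z] by simp
  qed
  let ?V = "insert h (set xs)" and ?E = "fan_edges h xs"
  have sg: "simple_graph ?V ?E" using assms by (intro simple_graph_fan)
  \<comment> \<open>With at least three rim vertices the closing edge is not yet a path edge:
    \<open>ys\<close> lies between x and z.\<close>
  have nE: "{z, x} \<notin> ?E"
  proof -
    have "{z, x} \<notin> path_edges xs"
    proof
      assume "{z, x} \<in> path_edges xs"
      moreover have "path_edges xs = insert {x, hd ys} (path_edges (ys @ [z]))"
        unfolding xs using \<open>ys \<noteq> []\<close> by (subst path_edges_Cons) auto
      ultimately have "{z, x} = {x, hd ys} \<or> {z, x} \<subseteq> set (ys @ [z])"
        using path_edges_mem[of "{z, x}" "ys @ [z]"] by auto
      moreover have "hd ys \<in> set ys" using \<open>ys \<noteq> []\<close> by simp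
      ultimately show False using assms(1) unfolding xs by (auto simp: doubleton_eq_iff)
    qed
    moreover have "{z, x} \<noteq> {y, h}" for y
      using assms(2) unfolding xs by (auto simp: doubleton_eq_iff)
    ultimately show ?thesis by (auto simp: fan_edges_def)
  qed
  have "cyclic_wheel_edges h xs = insert {z, x} ?E" by (simp add: cyclic_wheel_edges_def xs)
  then have "num_trees ?V (cyclic_wheel_edges h xs) =
      num_trees ?V ?E + card (separating_two_forests ?V ?E z x)"
    using num_trees_insert[OF sg _ _ _ nE] assms(1) by (auto simp: xs)
  also have "num_trees ?V ?E = fib (2 * length xs)"
    using num_trees_fan[OF assms(1,2)] by (simp add: xs)
  finally have "num_trees ?V (cyclic_wheel_edges h xs) =
      fib (2 * length xs) + card (separating_two_forests ?V ?E z x)" .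
  moreover have "card (separating_two_forests ?V ?E z x) + 2 = 2 * fib (2 * length ys + 3)"
  proof -
    \<comment> \<open>Reversing the rim keeps the fan and exchanges its ends, so
      \<open>sum_fan_arcs\<close> yields both sums.\<close>
    have rev: "rev xs = z # rev ys @ [x]" by (simp add: xs)
    have d: "distinct (rev xs)" "h \<notin> set (rev xs)" using assms by auto
    show ?thesis
      using card_separating_two_forests_hub[OF sg assms(2), of z x]
        sum_fan_arcs[OF assms(1,2)[unfolded xs]]
        sum_fan_arcs[OF d[unfolded rev]]
      unfolding rev[symmetric] xs[symmetric] fan_edges_rev set_rev length_rev
      by (simp add: xs)
  qed
  ultimately have "num_trees ?V (cyclic_wheel_edges h xs) + 2 =
      fib (2 * length xs) + 2 * fib (2 * length ys + 3)" by simp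
  moreover have "2 * length xs = Suc (2 * length ys + 3)" by (simp add: xs)
  ultimately show ?thesis by (simp only: lucas_Suc)
qed

text \<open>Cutting the rim at j gives the path \<open>ys @ i # xs\<close>. An arc through i leaves
  a fan containing j, with \<open>s\<close> rim vertices from \<open>ys\<close> and
  \<open>length xs - t\<close> from \<open>xs\<close>, which leads to
  \<open>sum_sum_fib_even\<close>.\<close>

lemma sum_wheel_arcs:
  assumes "distinct (i # xs @ j # ys)" "h \<notin> set (i # xs @ j # ys)"
  defines "W \<equiv> set (i # xs @ j # ys)" and "E \<equiv> cyclic_wheel_edges h (i # xs @ j # ys)"
  defines "g \<equiv> \<lambda>C. num_trees C (induced E C)"
  shows "(\<Sum>C | C \<subseteq> W - {j} \<and> i \<in> C. g C * g (insert h W - C)) +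
      fib (2 * (length xs + 1)) + fib (2 * (length ys + 1)) = fib (2 * (length xs + length ys + 2))"
proof -
  have "W - {j} = set (ys @ i # xs)" using assms(1) by (auto simp: W_def)
  then have "(\<Sum>C | C \<subseteq> W - {j} \<and> i \<in> C. g C * g (insert h W - C)) =
      (\<Sum>C | C \<subseteq> set (ys @ i # xs) \<and> i \<in> C. g C * g (insert h W - C))"
    by simp
  also have "\<dots> = (\<Sum>s\<le>length ys. \<Sum>t\<le>length xs. g (insert h W - set (drop s ys @ i # take t xs)))"
    unfolding g_def
  proof (rule sum_connected_in_path)
    have "E = cyclic_wheel_edges h ([j] @ ys @ i # xs)"
      unfolding E_def using cyclic_wheel_edges_rotate[of h "i # xs" "j # ys"] by simp
    then show "induced E (set (ys @ i # xs)) = path_edges (ys @ i # xs)"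
      using induced_cyclic_wheel_edges(2)[of "[j]" "ys @ i # xs" h] assms(1,2) by auto
  qed (use assms(1) in auto)
  also have "\<dots> = (\<Sum>s\<le>length ys. \<Sum>t\<le>length xs. fib (2 * (s + (length xs - t) + 1)))"
  proof (intro sum.cong refl)
    fix s t assume s: "s \<in> {..length ys}"
    \<comment> \<open>The rim is reread from the beginning of the arc \<open>?ps\<close>, so that
      its complement \<open>?qs\<close> is contiguous as well.\<close>
    let ?ps = "drop s ys @ i # take t xs" and ?qs = "drop t xs @ j # take s ys"
    have split: "i # xs @ j # ys = (i # take t xs @ ?qs) @ drop s ys" by simp
    then have "E = cyclic_wheel_edges h ((i # take t xs @ ?qs) @ drop s ys)"
      by (simp only: E_def)
    also have "\<dots> = cyclic_wheel_edges h (?ps @ ?qs)"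
      unfolding cyclic_wheel_edges_rotate[of h "i # take t xs @ ?qs"] by simp
    finally have E: "E = cyclic_wheel_edges h (?ps @ ?qs)" .
    have W: "W = set (?ps @ ?qs)"
    proof -
      have "set xs = set (take t xs) \<union> set (drop t xs)" "set ys = set (take s ys) \<union> set (drop s ys)"
        by (metis append_take_drop_id set_append)+
      then show ?thesis by (auto simp: W_def)
    qed
    have "distinct ((i # take t xs @ ?qs) @ drop s ys)" using assms(1) unfolding split .
    then have "distinct (drop s ys @ i # take t xs @ ?qs)"
      by (metis distinct_append inf_commute)
    then have d: "distinct (?ps @ ?qs)" by (simp only: append_assoc append_Cons)
    have h: "h \<notin> set (?ps @ ?qs)" using assms(2) unfolding W[symmetric] unfolding W_def .
    have "insert h W - set ?ps = insert h (set ?qs)"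
      unfolding W using d h by (intro insert_set_Diff_prefix) auto
    moreover have "induced E (insert h (set ?qs)) = fan_edges h ?qs"
      unfolding E using d h by (intro induced_cyclic_wheel_edges(1)) simp_all
    moreover have "num_trees (insert h (set ?qs)) (fan_edges h ?qs) = fib (2 * length ?qs)"
      using d h by (subst num_trees_fan) auto
    moreover have "length ?qs = s + (length xs - t) + 1" using s by simp
    ultimately show "g (insert h W - set ?ps) = fib (2 * (s + (length xs - t) + 1))"
      by (simp only: g_def)
  qed
  also have "\<dots> = (\<Sum>s\<le>length ys. \<Sum>t\<le>length xs. fib (2 * (s + t + 1)))"
    by (intro sum.cong refl
        sum.reindex_bij_witness[of _ "\<lambda>t. length xs - t" "\<lambda>t. length xs - t"]) auto
  finally show ?thesis using sum_sum_fib_even[of "length xs" "length ys"] by simp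
qed

text \<open>Reading the rim from j instead of i exchanges \<open>xs\<close> with \<open>ys\<close>,
  so the two sums of \<open>card_separating_two_forests_hub\<close> are equal.\<close>

lemma card_separating_cyclic_wheel:
  assumes "distinct (i # xs @ j # ys)" "h \<notin> set (i # xs @ j # ys)"
  shows "card (separating_two_forests (insert h (set (i # xs @ j # ys)))
        (cyclic_wheel_edges h (i # xs @ j # ys)) i j) +
      2 * fib (2 * (length xs + 1)) + 2 * fib (2 * (length ys + 1)) =
    2 * fib (2 * (length xs + length ys + 2))"
proof -
  let ?ws = "i # xs @ j # ys" and ?ws' = "j # ys @ i # xs"
  have E: "cyclic_wheel_edges h ?ws' = cyclic_wheel_edges h ?ws"
    using cyclic_wheel_edges_rotate[of h "j # ys" "i # xs"] by simp
  have W: "set ?ws' = set ?ws" by auto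
  have d: "distinct ?ws'" "h \<notin> set ?ws'" using assms by auto
  have "simple_graph (insert h (set ?ws)) (cyclic_wheel_edges h ?ws)"
    using assms by (intro simple_graph_cyclic_wheel) auto
  from card_separating_two_forests_hub[OF this assms(2), of i j]
    sum_wheel_arcs[OF assms] sum_wheel_arcs[OF d, unfolded E W]
  show ?thesis by (simp add: add.commute)
qed

section \<open>The numbered wheel as a cyclic list, and the theorem\<close>

lemma path_edges_upt: "path_edges [a..<b] = (\<lambda>i. {i, Suc i}) ` {a..<b - 1}"
proof (induction b)
  case (Suc b)
  show ?case
  proof (cases "a < b")
    case True
    then have "path_edges [a..<Suc b] = insert {b - 1, b} (path_edges [a..<b])"
      by (simp add: path_edges_append last_conv_nth)
    also have "{b - 1, b} = {b - 1, Suc (b - 1)}" using True by simp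
    also have "insert \<dots> (path_edges [a..<b]) = (\<lambda>i. {i, Suc i}) ` insert (b - 1) {a..<b - 1}"
      unfolding Suc by simp
    also have "insert (b - 1) {a..<b - 1} = {a..<Suc b - 1}" using True by auto
    finally show ?thesis .
  qed simp
qed simp

lemma wheel_edges_cyclic:
  assumes "n \<ge> 1"
  shows "wheel_edges n = cyclic_wheel_edges 0 [1..<Suc n]"
proof -
  have "{{0, i} |i. 1 \<le> i \<and> i \<le> n} = (\<lambda>x. {x, 0}) ` set [1..<Suc n]"
    by (auto simp: insert_commute simp del: upt_Suc)
  moreover have "{{i, i + 1} |i. 1 \<le> i \<and> i \<le> n - 1} = path_edges [1..<Suc n]"
    unfolding path_edges_upt using assms by force
  moreover have "{last [1..<Suc n], hd [1..<Suc n]} = {n, 1}"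
    using assms by (simp add: last_conv_nth hd_conv_nth del: upt_Suc)
  ultimately show ?thesis
    unfolding wheel_edges_def cyclic_wheel_edges_def fan_edges_def by simp
qed

lemma upt_split: "a \<le> b \<Longrightarrow> b \<le> c \<Longrightarrow> [a..<c] = [a..<b] @ [b..<c]"
  using upt_add_eq_append[of a b "c - b"] by simp

theorem theorem2:
  fixes n i j k :: nat
  assumes "n \<ge> 3"
    and "1 \<le> i" "i \<le> n" "1 \<le> j" "j \<le> n" "i \<noteq> j"
    and "int k = min \<bar>int i - int j\<bar> (int n - \<bar>int i - int j\<bar>)"
  shows "int (card (separating_two_forests (wheel_verts n) (wheel_edges n) i j))
           = int (fib (2 * k)) * int (card (spanning_trees (wheel_verts n) (wheel_edges n)))
             - int (fib (2 * n)) * (int (lucas (2 * k)) - 2)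
       \<and> int (fib (2 * k)) * int (card (spanning_trees (wheel_verts n) (wheel_edges n)))
             - int (fib (2 * n)) * (int (lucas (2 * k)) - 2)
           = int (fib (2 * k)) * (int (lucas (2 * n)) - 2)
             - int (fib (2 * n)) * (int (lucas (2 * k)) - 2)"
proof -
  let ?V = "wheel_verts n" and ?E = "wheel_edges n"
  have V: "?V = insert 0 (set [1..<Suc n])" by (auto simp: wheel_verts_def)
  have E: "?E = cyclic_wheel_edges 0 [1..<Suc n]" using assms(1) by (intro wheel_edges_cyclic) auto
  have "num_trees ?V ?E + 2 = lucas (2 * n)"
    using num_trees_cyclic_wheel[of "[1..<Suc n]" 0] assms(1) unfolding V E by (simp del: upt_Suc)
  then have trees: "int (num_trees ?V ?E) = int (lucas (2 * n)) - 2" by linarith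
  have sep: "card (separating_two_forests ?V ?E a b) + 2 * fib (2 * (b - a)) + 2 * fib (2 * (n - (b - a)))
      = 2 * fib (2 * n)" if ab: "1 \<le> a" "a < b" "b \<le> n" for a b
  proof -
    \<comment> \<open>The rim is read from a: \<open>?xs\<close> runs from a to b, and
      \<open>?ys\<close> runs from b past n and 1 back to a.\<close>
    let ?xs = "[Suc a..<b]" and ?ys = "[Suc b..<Suc n] @ [1..<a]"
    have "[1..<Suc n] = [1..<a] @ a # ?xs @ b # [Suc b..<Suc n]"
    proof -
      have "[1..<Suc n] = [1..<a] @ [a..<b] @ [b..<Suc n]"
        using ab upt_split[of 1 a "Suc n"] upt_split[of a b "Suc n"] by (simp only:)
      moreover have "[a..<b] = a # ?xs" "[b..<Suc n] = b # [Suc b..<Suc n]"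
        using ab by (auto simp: upt_conv_Cons simp del: upt_Suc)
      ultimately show ?thesis by simp
    qed
    then have rot: "[1..<Suc n] = [1..<a] @ (a # ?xs @ b # [Suc b..<Suc n])" by simp
    let ?ws = "a # ?xs @ b # ?ys"
    have E': "?E = cyclic_wheel_edges 0 ?ws"
      unfolding E rot cyclic_wheel_edges_rotate[of 0 "[1..<a]"] by simp
    have V': "?V = insert 0 (set ?ws)" unfolding V rot by auto
    have "distinct ?ws" "0 \<notin> set ?ws" using ab by auto
    from card_separating_cyclic_wheel[OF this, folded V' E']
    have "card (separating_two_forests ?V ?E a b) + 2 * fib (2 * (length ?xs + 1)) +
        2 * fib (2 * (length ?ys + 1)) = 2 * fib (2 * (length ?xs + length ?ys + 2))" .
    moreover have "length ?xs + 1 = b - a" "length ?ys + 1 = n - (b - a)"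
      "length ?xs + length ?ys + 2 = n" using ab by auto
    ultimately show ?thesis by (simp only:)
  qed
  have "k \<le> n" and count: "card (separating_two_forests ?V ?E i j) + 2 * fib (2 * k) +
      2 * fib (2 * (n - k)) = 2 * fib (2 * n)"
  proof -
    \<comment> \<open>k is the length of one of the two rim arcs between i and j and n - k that of
      the other. The count is symmetric in these lengths, so it does not matter which is
      shorter.\<close>
    have "(i < j \<and> (k = j - i \<or> k = n - (j - i))) \<or> (j < i \<and> (k = i - j \<or> k = n - (i - j)))"
      using assms by (auto simp: min_def split: if_splits)
    then show "k \<le> n" "card (separating_two_forests ?V ?E i j) + 2 * fib (2 * k) +
        2 * fib (2 * (n - k)) = 2 * fib (2 * n)"
      using sep[of i j] sep[of j i] assms(2-5) separating_commute[of ?V ?E i j] by auto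
  qed
  \<comment> \<open>With d = n - k the identity replaces the term in n - k by the products of
    Fibonacci and Lucas numbers in the claim.\<close>
  from fib_lucas_even_diff[of k "n - k"] \<open>k \<le> n\<close>
  have "int (fib (2 * n)) * int (lucas (2 * k)) - int (fib (2 * k)) * int (lucas (2 * n)) =
      2 * int (fib (2 * (n - k)))" by simp
  moreover have "int (card (separating_two_forests ?V ?E i j)) =
      2 * int (fib (2 * n)) - 2 * int (fib (2 * k)) - 2 * int (fib (2 * (n - k)))"
    using count by linarith
  ultimately show ?thesis unfolding trees by (simp add: algebra_simps)
qed

end
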